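(* Let $\eta\ge1$, $\delta\in[0,1)$, and let $A$ be an $\eta$-distance approximation algorithm with additive error $\delta$ for a property $\mathcal{P}$ of functions $f:\mathcal{D}\to\mathcal{R}$. Then there exists an $\alpha$-erasure-resilient $\varepsilon$-tester $A'$ for $\mathcal{P}$ that makes the same number of queries as $A$ and works for all $\varepsilon,\alpha\in(0,1)$ satisfying $\alpha<\frac{\varepsilon-\delta\eta}{\varepsilon+\eta}$.
   Context: For a property $\mathcal{P}$ and $f:\mathcal{D}\to\mathcal{R}$, $\varepsilon_{\mathcal{P}}(f)$ is the relative Hamming distance of $f$ to $\mathcal{P}$ (minimum fraction of $\mathcal{D}$ on which $f$ must be changed to lie in $\mathcal{P}$). An algorithm $A$ is an $\eta$-distance approximation algorithm with additive error $\delta$ for $\mathcal{P}$ if, given oracle access to any $f$, it outputs with probability at least $2/3$ a value $\hat\varepsilon$ with $\frac{1}{\eta}\varepsilon_{\mathcal{P}}(f)-\delta\le\hat\varepsilon\le\varepsilon_{\mathcal{P}}(f)$. An $\alpha$-erased function $g:\mathcal{D}\to\mathcal{R}\cup\{\perp\}$ equals $\perp$ (erased) on at most an $\alpha$ fraction of $\mathcal{D}$, with nonerased set $\mathcal{N}$; a restoration is a function $\mathcal{D}\to\mathcal{R}$ agreeing with $g$ on $\mathcal{N}$. An $\alpha$-erasure-resilient $\varepsilon$-tester for $\mathcal{P}$, with query access to $g$ (queries return $g(x)$ or $\perp$; $\mathcal{N}$ unknown), with probability at least $2/3$ accepts if some restoration lies in $\mathcal{P}$ and rejects if every restoration must be changed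 on at least an $\varepsilon$ fraction of $\mathcal{N}$ to lie in $\mathcal{P}$. *)

theory Defs
  imports "HOL-Probability.Probability"
begin

text \<open>
  The domain is a finite (nonempty) type \<open>'d\<close>, the range an arbitrary type \<open>'r\<close>, and a
  property is a set of functions \<open>'d \<Rightarrow> 'r\<close>. Partially erased functions have type
  \<open>'d \<Rightarrow> 'r option\<close>, with \<open>None\<close> as the erasure symbol.
\<close>

section \<open>Randomized algorithms with oracle access\<close>

datatype ('d, 'a, 'o) decision_tree =
  Output 'o
| Query 'd "'a \<Rightarrow> ('d, 'a, 'o) decision_tree"

primrec run :: "('d \<Rightarrow> 'a) \<Rightarrow> ('d, 'a, 'o) decision_tree \<Rightarrow> 'o" where
  "run f (Output z) = z"
| "run f (Query x k) = run f (k (f x))"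

primrec num_queries :: "('d \<Rightarrow> 'a) \<Rightarrow> ('d, 'a, 'o) decision_tree \<Rightarrow> nat" where
  "num_queries f (Output z) = 0"
| "num_queries f (Query x k) = Suc (num_queries f (k (f x)))"

text \<open>
  A randomized algorithm draws a random seed from the probability space \<open>coins\<close>; once the seed
  is fixed, it is a deterministic adaptive query strategy, i.e. a decision tree. It is an
  algorithm in the sense of query complexity: no computability or running time is modelled.
\<close>

datatype ('s, 'd, 'a, 'o) algorithm =
  Algorithm (coins: "'s measure") (strategy: "'s \<Rightarrow> ('d, 'a, 'o) decision_tree")

definition output_on ::
  "('s, 'd, 'a, 'o) algorithm \<Rightarrow> ('d \<Rightarrow> 'a) \<Rightarrow> 's \<Rightarrow> 'o" where
  "output_on A f s = run f (strategy A s)"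

text \<open>The output on every oracle has to be a random variable with values in the space \<open>V\<close>.\<close>

definition randomized_algorithm :: "'o measure \<Rightarrow> ('s, 'd, 'a, 'o) algorithm \<Rightarrow> bool" where
  "randomized_algorithm V A \<longleftrightarrow>
     prob_space (coins A) \<and> (\<forall>f. output_on A f \<in> measurable (coins A) V)"

definition prob_output ::
  "('s, 'd, 'a, 'o) algorithm \<Rightarrow> ('d \<Rightarrow> 'a) \<Rightarrow> ('o \<Rightarrow> bool) \<Rightarrow> real" where
  "prob_output A f Q = measure (coins A) {s \<in> space (coins A). Q (output_on A f s)}"

text \<open>Worst case over all oracles and all seeds; \<open>\<infinity>\<close> if unbounded.\<close>

definition query_complexity :: "('s, 'd, 'a, 'o) algorithm \<Rightarrow> enat" where
  "query_complexity A = (SUP f. SUP s\<in>space (coins A). enat (num_queries f (strategy A s)))"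


section \<open>Distance to a property and distance approximation\<close>

definition rel_hamming :: "('d::finite \<Rightarrow> 'r) \<Rightarrow> ('d \<Rightarrow> 'r) \<Rightarrow> real" where
  "rel_hamming f h = real (card {x. f x \<noteq> h x}) / real CARD('d)"

text \<open>
  The minimum is taken over a finite set of reals, even if \<open>P\<close> is infinite. It is unspecified
  for \<open>P = {}\<close>.
\<close>

definition dist_to :: "('d::finite \<Rightarrow> 'r) set \<Rightarrow> ('d \<Rightarrow> 'r) \<Rightarrow> real" where
  "dist_to P f = Min (rel_hamming f ` P)"

definition distance_approximation ::
  "real \<Rightarrow> real \<Rightarrow> ('d::finite \<Rightarrow> 'r) set \<Rightarrow> ('s, 'd, 'r, real) algorithm \<Rightarrow> bool" where
  "distance_approximation \<eta> \<delta> P A \<longleftrightarrow>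
     randomized_algorithm borel A \<and>
     (\<forall>f. prob_output A f (\<lambda>e. 1 / \<eta> * dist_to P f - \<delta> \<le> e \<and> e \<le> dist_to P f) \<ge> 2 / 3)"


section \<open>Erasure-resilient testing\<close>

definition nonerased :: "('d \<Rightarrow> 'r option) \<Rightarrow> 'd set" where
  "nonerased g = {x. g x \<noteq> None}"

definition erased_function :: "real \<Rightarrow> ('d::finite \<Rightarrow> 'r option) \<Rightarrow> bool" where
  "erased_function \<alpha> g \<longleftrightarrow> real (card {x. g x = None}) \<le> \<alpha> * real CARD('d)"

definition restoration :: "('d \<Rightarrow> 'r option) \<Rightarrow> ('d \<Rightarrow> 'r) \<Rightarrow> bool" where
  "restoration g f \<longleftrightarrow> (\<forall>x\<in>nonerased g. g x = Some (f x))"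

definition erasure_far ::
  "real \<Rightarrow> ('d::finite \<Rightarrow> 'r) set \<Rightarrow> ('d \<Rightarrow> 'r option) \<Rightarrow> bool" where
  "erasure_far \<epsilon> P g \<longleftrightarrow>
     (\<forall>f. restoration g f \<longrightarrow>
       (\<forall>h\<in>P. real (card {x\<in>nonerased g. f x \<noteq> h x}) \<ge> \<epsilon> * real (card (nonerased g))))"

datatype verdict = Accept | Reject

definition erasure_resilient_tester ::
  "real \<Rightarrow> real \<Rightarrow> ('d::finite \<Rightarrow> 'r) set \<Rightarrow> ('s, 'd, 'r option, verdict) algorithm \<Rightarrow> bool"
where
  "erasure_resilient_tester \<alpha> \<epsilon> P T \<longleftrightarrow>
     randomized_algorithm (count_space UNIV) T \<and>
     (\<forall>g. erased_function \<alpha> g \<longrightarrow>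
        ((\<exists>f\<in>P. restoration g f) \<longrightarrow> prob_output T g (\<lambda>v. v = Accept) \<ge> 2 / 3) \<and>
        (erasure_far \<epsilon> P g \<longrightarrow> prob_output T g (\<lambda>v. v = Reject) \<ge> 2 / 3))"

end

theory Submission
  imports Defs
begin

text \<open>
  The tester replaces every erased answer by a fixed default value, runs \<open>A\<close> on the resulting
  restoration \<open>f\<close> and accepts iff the estimate is at most \<open>\<alpha>\<close>. If some restoration has the
  property, then \<open>f\<close> has distance at most \<open>\<alpha>\<close>. If \<open>g\<close> is \<open>\<epsilon>\<close>-far, then \<open>f\<close> has distance at least
  \<open>\<epsilon> (1 - \<alpha>)\<close>, so the estimate is at least \<open>\<epsilon> (1 - \<alpha>) / \<eta> - \<delta>\<close>, which exceeds \<open>\<alpha>\<close>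
  by the bound on \<open>\<alpha>\<close>.
\<close>

text \<open>The wrapper that turns \<open>A\<close> into a tester while leaving its queries alone:
  \<open>c\<close> will fill in erased answers and \<open>v\<close> will turn the estimate into a
  verdict.\<close>

primrec lift_tree ::
  "('b \<Rightarrow> 'a) \<Rightarrow> ('o \<Rightarrow> 'p) \<Rightarrow> ('d, 'a, 'o) decision_tree \<Rightarrow> ('d, 'b, 'p) decision_tree" where
  "lift_tree c v (Output z) = Output (v z)"
| "lift_tree c v (Query x k) = Query x (\<lambda>b. lift_tree c v (k (c b)))"

lemma run_lift_tree: "run g (lift_tree c v t) = v (run (c \<circ> g) t)"
  by (induction t) auto

lemma num_queries_lift_tree: "num_queries g (lift_tree c v t) = num_queries (c \<circ> g) t"
  by (induction t) auto

definition lift_algorithm ::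
  "('b \<Rightarrow> 'a) \<Rightarrow> ('o \<Rightarrow> 'p) \<Rightarrow> ('s, 'd, 'a, 'o) algorithm \<Rightarrow> ('s, 'd, 'b, 'p) algorithm" where
  "lift_algorithm c v A = Algorithm (coins A) (\<lambda>s. lift_tree c v (strategy A s))"

lemma coins_lift_algorithm [simp]: "coins (lift_algorithm c v A) = coins A"
  by (simp add: lift_algorithm_def)

lemma output_on_lift_algorithm: "output_on (lift_algorithm c v A) g s = v (output_on A (c \<circ> g) s)"
  by (simp add: lift_algorithm_def output_on_def run_lift_tree)

lemma prob_output_lift_algorithm:
  "prob_output (lift_algorithm c v A) g Q = prob_output A (c \<circ> g) (\<lambda>e. Q (v e))"
  by (simp add: prob_output_def output_on_lift_algorithm)

lemma randomized_algorithm_lift_algorithm: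
  assumes "randomized_algorithm V A" and "v \<in> measurable V W"
  shows "randomized_algorithm W (lift_algorithm c v A)"
proof -
  have "output_on (lift_algorithm c v A) g = v \<circ> output_on A (c \<circ> g)" for g
    by (simp add: fun_eq_iff output_on_lift_algorithm)
  with assms show ?thesis
    by (auto simp: randomized_algorithm_def intro: measurable_comp)
qed

text \<open>On oracle \<open>g\<close> the new algorithm asks what \<open>A\<close> asks on
  \<open>c \<circ> g\<close>. For surjective \<open>c\<close> every oracle of \<open>A\<close> has
  this form, so both suprema run over the same values, which gives equality and not just an upper
  bound.\<close>

lemma query_complexity_lift_algorithm:
  fixes A :: "('s, 'd, 'a, 'o) algorithm" and c :: "'b \<Rightarrow> 'a"
  assumes "surj c"
  shows "query_complexity (lift_algorithm c v A) = query_complexity A"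
proof -
  define F where "F = (\<lambda>f. SUP s\<in>space (coins A). enat (num_queries f (strategy A s)))"
  have surj: "range (\<lambda>g :: 'd \<Rightarrow> 'b. c \<circ> g) = UNIV"
  proof (rule surjI)
    show "c \<circ> (inv c \<circ> f) = f" for f :: "'d \<Rightarrow> 'a"
      using assms by (simp add: fun_eq_iff surj_f_inv_f)
  qed
  have "query_complexity (lift_algorithm c v A) = (SUP g. F (c \<circ> g))"
    by (simp add: query_complexity_def lift_algorithm_def num_queries_lift_tree F_def)
  also have "\<dots> = Sup (F ` range (\<lambda>g. c \<circ> g))"
    by (simp only: image_image)
  also have "\<dots> = query_complexity A"
    by (simp only: surj F_def query_complexity_def)
  finally show ?thesis .
qed

text \<open>Measurability of the larger event suffices: a nonmeasurable smaller event gets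
  \<open>measure\<close> 0.\<close>

lemma prob_output_mono:
  assumes A: "randomized_algorithm V A" and R: "{x \<in> space V. R x} \<in> sets V"
    and "\<And>e. Q e \<Longrightarrow> R e"
  shows "prob_output A f Q \<le> prob_output A f R"
proof -
  interpret prob_space "coins A"
    using A by (simp add: randomized_algorithm_def)
  have "output_on A f \<in> measurable (coins A) V"
    using A by (simp add: randomized_algorithm_def)
  then have "{s \<in> space (coins A). R (output_on A f s)} \<in> sets (coins A)"
    using R by (rule measurable_sets_Collect)
  then show ?thesis
    unfolding prob_output_def using assms(3) by (intro finite_measure_mono) auto
qed

lemma prob_output_True:
  assumes "randomized_algorithm V A"
  shows "prob_output A f (\<lambda>_. True) = 1"
  using assms by (simp add: randomized_algorithm_def prob_output_def prob_space.prob_space)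

text \<open>All distances are multiples of 1 / \<open>CARD('d)\<close> between 0 and 1, so the
  \<open>Min\<close> in \<open>dist_to\<close> is well behaved even for infinite
  \<open>P\<close>.\<close>

lemma finite_rel_hamming_image: "finite (rel_hamming (f :: 'd::finite \<Rightarrow> 'r) ` P)"
proof -
  have "rel_hamming f ` P \<subseteq> (\<lambda>k. real k / real CARD('d)) ` {..CARD('d)}"
    by (auto simp: rel_hamming_def intro!: imageI card_mono)
  then show ?thesis
    by (rule finite_subset) simp
qed

lemma dist_to_le: "h \<in> P \<Longrightarrow> dist_to P f \<le> rel_hamming f h"
  by (simp add: dist_to_def finite_rel_hamming_image)

lemma le_dist_to:
  assumes "P \<noteq> {}" and "\<And>h. h \<in> P \<Longrightarrow> b \<le> rel_hamming f h"
  shows "b \<le> dist_to P f"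
  using assms by (simp add: dist_to_def finite_rel_hamming_image)

lemma restoration_case_option: "restoration g (case_option r id \<circ> g)"
  by (auto simp: restoration_def nonerased_def)

text \<open>Two restorations of \<open>g\<close> can disagree only at erased points.\<close>

lemma rel_hamming_restorations_le:
  fixes g :: "'d::finite \<Rightarrow> 'r option"
  assumes "erased_function \<alpha> g" and "restoration g f" and "restoration g h"
  shows "rel_hamming f h \<le> \<alpha>"
proof -
  have "{x. f x \<noteq> h x} \<subseteq> {x. g x = None}"
    using assms(2,3) by (force simp: restoration_def nonerased_def)
  then have "card {x. f x \<noteq> h x} \<le> card {x. g x = None}"
    by (intro card_mono) auto
  then have "real (card {x. f x \<noteq> h x}) \<le> \<alpha> * real CARD('d)"
    using assms(1) by (simp add: erased_function_def)
  then show ?thesis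
    by (simp add: rel_hamming_def divide_le_eq)
qed

lemma card_nonerased_ge:
  fixes g :: "'d::finite \<Rightarrow> 'r option"
  assumes "erased_function \<alpha> g"
  shows "(1 - \<alpha>) * real CARD('d) \<le> real (card (nonerased g))"
proof -
  have "nonerased g = - {x. g x = None}"
    by (auto simp: nonerased_def)
  then have "card (nonerased g) = CARD('d) - card {x. g x = None}"
    by (simp add: Compl_eq_Diff_UNIV card_Diff_subset)
  then have "real (card (nonerased g)) = real CARD('d) - real (card {x. g x = None})"
    by (simp add: of_nat_diff card_mono)
  with assms show ?thesis
    by (simp add: erased_function_def algebra_simps)
qed

text \<open>Disagreements inside the nonerased set already number at least \<epsilon> times its
  size, and that set fills at least a fraction 1 - \<alpha> of the domain.\<close>

lemma erasure_far_rel_hamming_ge: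
  fixes g :: "'d::finite \<Rightarrow> 'r option"
  assumes "erased_function \<alpha> g" and "erasure_far \<epsilon> P g" and "0 \<le> \<epsilon>"
    and "restoration g f" and "h \<in> P"
  shows "\<epsilon> * (1 - \<alpha>) \<le> rel_hamming f h"
proof -
  have "\<epsilon> * ((1 - \<alpha>) * real CARD('d)) \<le> \<epsilon> * real (card (nonerased g))"
    using assms by (intro mult_left_mono card_nonerased_ge)
  also have "\<dots> \<le> real (card {x \<in> nonerased g. f x \<noteq> h x})"
    using assms by (simp add: erasure_far_def)
  also have "\<dots> \<le> real (card {x. f x \<noteq> h x})"
    by (simp add: card_mono Collect_mono_iff)
  finally show ?thesis
    by (simp add: rel_hamming_def le_divide_eq mult.assoc)
qed

text \<open>
  The conjunct \<open>P \<noteq> {}\<close> is needed because \<open>dist_to {}\<close> is a junk value, which makes the estimate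
  uninformative; everything is far from the empty property.
\<close>

definition threshold_verdict :: "'a set \<Rightarrow> real \<Rightarrow> real \<Rightarrow> verdict" where
  "threshold_verdict P \<alpha> e = (if P \<noteq> {} \<and> e \<le> \<alpha> then Accept else Reject)"

lemma measurable_threshold_verdict:
  "threshold_verdict P \<alpha> \<in> measurable borel (count_space UNIV)"
  unfolding threshold_verdict_def by measurable

lemma erasure_resilient_tester_threshold:
  fixes P :: "('d::finite \<Rightarrow> 'r) set"
  assumes \<eta>: "\<eta> > 0" and A: "distance_approximation \<eta> \<delta> P A"
    and \<epsilon>: "\<epsilon> > 0" and \<alpha>: "\<alpha> < (\<epsilon> - \<delta> * \<eta>) / (\<epsilon> + \<eta>)"
  shows "erasure_resilient_tester \<alpha> \<epsilon> P
    (lift_algorithm (case_option r id) (threshold_verdict P \<alpha>) A)"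
    (is "erasure_resilient_tester \<alpha> \<epsilon> P ?T")
  unfolding erasure_resilient_tester_def
proof (intro conjI allI impI)
  have rand: "randomized_algorithm borel A"
    using A by (simp add: distance_approximation_def)
  show "randomized_algorithm (count_space UNIV) ?T"
    using rand measurable_threshold_verdict by (rule randomized_algorithm_lift_algorithm)
  fix g :: "'d \<Rightarrow> 'r option"
  assume g: "erased_function \<alpha> g"
  define f where "f = case_option r id \<circ> g"
  have f: "restoration g f"
    unfolding f_def by (rule restoration_case_option)
  have approx: "2 / 3 \<le> prob_output A f (\<lambda>e. 1 / \<eta> * dist_to P f - \<delta> \<le> e \<and> e \<le> dist_to P f)"
    using A by (simp add: distance_approximation_def)
  have T: "prob_output ?T g Q = prob_output A f (\<lambda>e. Q (threshold_verdict P \<alpha> e))" for Q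
    by (simp add: prob_output_lift_algorithm f_def)
  {
    assume "\<exists>h\<in>P. restoration g h"
    then obtain h where h: "h \<in> P" "restoration g h"
      by blast
    have "dist_to P f \<le> \<alpha>"
      using dist_to_le[OF h(1)] rel_hamming_restorations_le[OF g f h(2)] by (rule order_trans)
    \<comment> \<open>Acceptance rests on the upper bound for the estimate; rejection below rests on
      the lower bound.\<close>
    then have "threshold_verdict P \<alpha> e = Accept" if "e \<le> dist_to P f" for e
      using h(1) that by (auto simp: threshold_verdict_def)
    moreover have "{e. threshold_verdict P \<alpha> e = Accept} \<in> sets borel"
      by (simp add: threshold_verdict_def)
    ultimately show "2 / 3 \<le> prob_output ?T g (\<lambda>v. v = Accept)"
      unfolding T by (intro order_trans[OF approx] prob_output_mono[OF rand]) auto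
  next
    assume far: "erasure_far \<epsilon> P g"
    show "2 / 3 \<le> prob_output ?T g (\<lambda>v. v = Reject)"
    proof (cases "P = {}")
      case True
      then show ?thesis
        unfolding T by (simp add: threshold_verdict_def prob_output_True[OF rand])
    next
      case False
      have "\<epsilon> * (1 - \<alpha>) \<le> dist_to P f"
        using False \<epsilon> by (intro le_dist_to erasure_far_rel_hamming_ge[OF g far _ f]) auto
      \<comment> \<open>This is the assumed bound on \<alpha>, multiplied by \<epsilon> + \<eta> > 0
        and regrouped.\<close>
      moreover have "(\<alpha> + \<delta>) * \<eta> < \<epsilon> * (1 - \<alpha>)"
        using \<alpha> \<eta> \<epsilon> by (simp add: less_divide_eq algebra_simps)
      ultimately have "(\<alpha> + \<delta>) * \<eta> < dist_to P f"
        by simp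
      then have "\<alpha> < 1 / \<eta> * dist_to P f - \<delta>"
        using \<eta> by (simp add: field_simps)
      then have "threshold_verdict P \<alpha> e = Reject" if "1 / \<eta> * dist_to P f - \<delta> \<le> e" for e
        using that by (auto simp: threshold_verdict_def)
      \<comment> \<open>For nonempty \<open>P\<close> this set is the open half-line above
        \<alpha>.\<close>
      moreover have "{e. threshold_verdict P \<alpha> e = Reject} \<in> sets borel"
        using False by (simp add: threshold_verdict_def flip: not_less)
      ultimately show ?thesis
        unfolding T by (intro order_trans[OF approx] prob_output_mono[OF rand]) auto
    qed
  }
qed

theorem theorem7p10:
  fixes \<eta> \<delta> :: real
    and P :: "('d::finite \<Rightarrow> 'r) set"
    and A :: "('s, 'd, 'r, real) algorithm"
  assumes "\<eta> \<ge> 1" and "0 \<le> \<delta>" and "\<delta> < 1"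
    and "distance_approximation \<eta> \<delta> P A"
  shows "\<exists>A' :: real \<Rightarrow> real \<Rightarrow> ('s, 'd, 'r option, verdict) algorithm.
    \<forall>\<alpha> \<epsilon>. 0 < \<alpha> \<and> \<alpha> < 1 \<and> 0 < \<epsilon> \<and> \<epsilon> < 1 \<and> \<alpha> < (\<epsilon> - \<delta> * \<eta>) / (\<epsilon> + \<eta>) \<longrightarrow>
      erasure_resilient_tester \<alpha> \<epsilon> P (A' \<alpha> \<epsilon>) \<and>
      query_complexity (A' \<alpha> \<epsilon>) = query_complexity A"
proof (intro exI allI impI conjI)
  fix \<alpha> \<epsilon> :: real
  assume *: "0 < \<alpha> \<and> \<alpha> < 1 \<and> 0 < \<epsilon> \<and> \<epsilon> < 1 \<and> \<alpha> < (\<epsilon> - \<delta> * \<eta>) / (\<epsilon> + \<eta>)"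
  \<comment> \<open>Any default value in place of \<open>undefined\<close> would do. The tester
    depends on \<alpha> through its threshold and is the same for all \<epsilon>.\<close>
  let ?T = "lift_algorithm (case_option undefined id) (threshold_verdict P \<alpha>) A"
  show "erasure_resilient_tester \<alpha> \<epsilon> P ?T"
    using assms * by (intro erasure_resilient_tester_threshold) auto
  \<comment> \<open>Every oracle \<open>f\<close> of \<open>A\<close> arises from the erasure-free
    input \<open>Some \<circ> f\<close>.\<close>
  have "surj (case_option undefined id :: 'r option \<Rightarrow> 'r)"
    by (rule surjI[where f = Some]) simp
  then show "query_complexity ?T = query_complexity A"
    by (rule query_complexity_lift_algorithm)
qed

end
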